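(* Let $p^*\in(0,1]$ be a fixed channel access probability, and let $\mathbb{P}_o(p^*,\mathbf{b})$ be the offloading gain defined in the context, with $P:=\mathbb{P}(R_1>R_0)$ the quantity defined in the context for $p=p^*$. Then $\mathbb{P}_o(p^*,\mathbf{b})$ is a concave function of $\mathbf{b}=(b_1,\dots,b_{N_f})\in[0,1]^{N_f}$, and the optimal solution $\mathbf{b}^*$ of the problem $$\max_{\mathbf{b}}\ \mathbb{P}_o(p^*,\mathbf{b})\quad\text{s.t.}\quad \sum_{i=1}^{N_f}b_i=M,\qquad b_i\in[0,1]\ \text{ for all } i,$$ is given by $$b_i^*=\begin{cases}1, & v^*<q_i-q_i(1-e^{-\overline n})P,\\[2pt] 0,& v^*>q_i+\overline n\,q_i\,P,\\[2pt] \psi_i(v^* ),&\text{otherwise,}\end{cases}$$ where $\psi_i(v^* )$ denotes the solution $b_i^*\in[0,1]$ of $$v^*=q_i+q_i\Big(\overline n(1-b_i^* )e^{-\overline n b_i^*}-(1-e^{-\overline n b_i^*})\Big)P,$$ and the real number $v^*$ is such that $\sum_{i=1}^{N_f}b_i^*=M$.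
   Context: Parameters: integers $1\le M<N_f$ (cache size per device, library size); $\overline n>0$ (mean number of devices per cluster); $\lambda_p,\sigma,\theta>0$ and $\alpha>2$. File popularity is Zipf: $q_i=\frac{i^{-\beta}}{\sum_{k=1}^{N_f}k^{-\beta}}$ for $i=1,\dots,N_f$, with $\beta\ge0$. The number $b_i$ is the probability that a device caches file $i$. The offloading gain is $$\mathbb{P}_o(p,\mathbf{b})=\sum_{i=1}^{N_f}\Big[q_ib_i+q_i(1-b_i)(1-e^{-b_i\overline n})\,\mathbb{P}(R_1>R_0)\Big],$$ where $\mathbb{P}(R_1>R_0)$, the probability that the device-to-device rate exceeds a required threshold, depends on $p$ but not on $\mathbf{b}$, and is given by $$\mathbb{P}(R_1>R_0)=\int_0^\infty\frac{r}{2\sigma^2}e^{-\frac{r^2}{4\sigma^2}}\,A(\theta r^\alpha)\,B(\theta r^\alpha)\,dr,$$ $$A(t)=\exp\Big(-2\pi\lambda_p\int_0^\infty\Big(1-\exp\Big(-p\overline n\int_0^\infty\frac{t}{t+u^\alpha}f_U(u|v)\,du\Big)\Big)v\,dv\Big),$$ $$B(t)=\exp\Big(-p\overline n\int_0^\infty\frac{t}{t+h^\alpha}\frac{h}{2\sigma^2}e^{-\frac{h^2}{4\sigma^2}}\,dh\Big),$$ with $f_U(u|v)=\frac{u}{\sigma^2}\exp\big(-\frac{u^2+v^2}{2\sigma^2}\big)I_0\big(\frac{uv}{\sigma^2}\big)$ the Rice density ($I_0$ is the modified Bessel function of the first kind of order zero). *)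

theory Defs
  imports "HOL-Analysis.Analysis"
begin

definition zipf :: "nat \<Rightarrow> real \<Rightarrow> nat \<Rightarrow> real" where
  "zipf N \<beta> i = real i powr (- \<beta>) / (\<Sum>k = 1..N. real k powr (- \<beta>))"

(* Modified Bessel function of the first kind of order zero, by its power series. *)
definition bessel_I0 :: "real \<Rightarrow> real" where
  "bessel_I0 x = (\<Sum>k. (x / 2) ^ (2 * k) / (fact k)\<^sup>2)"

definition rice_density :: "real \<Rightarrow> real \<Rightarrow> real \<Rightarrow> real" where
  "rice_density \<sigma> v u =
     u / \<sigma>\<^sup>2 * exp (- (u\<^sup>2 + v\<^sup>2) / (2 * \<sigma>\<^sup>2)) * bessel_I0 (u * v / \<sigma>\<^sup>2)"

(* The integrals below are Lebesgue integrals over the open half-line; for positive parameters,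
   alpha > 2 and t > 0 they all converge, so the value 0 that the library assigns to a
   non-integrable function never occurs. *)

definition inter_cluster_factor ::
    "real \<Rightarrow> real \<Rightarrow> real \<Rightarrow> real \<Rightarrow> real \<Rightarrow> real \<Rightarrow> real" where
  "inter_cluster_factor lam \<sigma> \<alpha> n p t =
     exp (- 2 * pi * lam *
       (LBINT v:{0<..}.
          (1 - exp (- p * n *
                 (LBINT u:{0<..}. t / (t + u powr \<alpha>) * rice_density \<sigma> v u))) * v))"

definition intra_cluster_factor ::
    "real \<Rightarrow> real \<Rightarrow> real \<Rightarrow> real \<Rightarrow> real \<Rightarrow> real" where
  "intra_cluster_factor \<sigma> \<alpha> n p t =
     exp (- p * n *
       (LBINT h:{0<..}.
          t / (t + h powr \<alpha>) * (h / (2 * \<sigma>\<^sup>2)) * exp (- h\<^sup>2 / (4 * \<sigma>\<^sup>2))))"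

(* The probability that the device-to-device rate exceeds the required threshold. *)
definition d2d_success_prob ::
    "real \<Rightarrow> real \<Rightarrow> real \<Rightarrow> real \<Rightarrow> real \<Rightarrow> real \<Rightarrow> real" where
  "d2d_success_prob lam \<sigma> \<theta> \<alpha> n p =
     (LBINT r:{0<..}. r / (2 * \<sigma>\<^sup>2) * exp (- r\<^sup>2 / (4 * \<sigma>\<^sup>2))
        * inter_cluster_factor lam \<sigma> \<alpha> n p (\<theta> * r powr \<alpha>)
        * intra_cluster_factor \<sigma> \<alpha> n p (\<theta> * r powr \<alpha>))"

(* q i is the popularity of file i, n the mean number of devices per cluster. *)
definition offloading_gain ::
    "real \<Rightarrow> real \<Rightarrow> real \<Rightarrow> real \<Rightarrow> real \<Rightarrow> ('f::finite \<Rightarrow> real) \<Rightarrow> real \<Rightarrow> real ^ 'f \<Rightarrow> real" where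
  "offloading_gain lam \<sigma> \<theta> \<alpha> n q p b =
     (\<Sum>i\<in>UNIV. q i * b $ i
        + q i * (1 - b $ i) * (1 - exp (- (b $ i) * n)) * d2d_success_prob lam \<sigma> \<theta> \<alpha> n p)"

definition feasible :: "nat \<Rightarrow> real ^ 'f::finite \<Rightarrow> bool" where
  "feasible M b \<longleftrightarrow> (\<Sum>i\<in>UNIV. b $ i) = real M \<and> (\<forall>i. b $ i \<in> {0..1})"

definition psi_eq :: "real \<Rightarrow> real \<Rightarrow> real \<Rightarrow> real \<Rightarrow> real \<Rightarrow> bool" where
  "psi_eq n P q v x \<longleftrightarrow>
     v = q + q * (n * (1 - x) * exp (- n * x) - (1 - exp (- n * x))) * P"

definition psi :: "real \<Rightarrow> real \<Rightarrow> real \<Rightarrow> real \<Rightarrow> real" where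
  "psi n P q v = (THE x. x \<in> {0..1} \<and> psi_eq n P q v x)"

definition opt_caching :: "real \<Rightarrow> real \<Rightarrow> ('f::finite \<Rightarrow> real) \<Rightarrow> real \<Rightarrow> real ^ 'f" where
  "opt_caching n P q v =
     (\<chi> i. if v < q i - q i * (1 - exp (- n)) * P then 1
           else if v > q i + n * q i * P then 0
           else psi n P (q i) v)"

end

theory Submission
  imports Defs
begin

text \<open>
  The gain splits into one function of \<open>b\<^sub>i\<close> per file, whose derivative, the marginal gain, is
  strictly decreasing on \<open>[0, 1]\<close> because \<open>P > 0\<close>. The component \<open>b\<^sub>i\<^sup>*\<close> is the point where the
  marginal gain crosses the level \<open>v\<close>, truncated to \<open>[0, 1]\<close>; it satisfies the KKT conditions with
  multiplier \<open>v\<close>, so the strict tangent inequality makes it the unique maximiser. As the slope of the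
  marginal gain is bounded away from 0, \<open>b\<^sub>i\<^sup>*\<close> is a Lipschitz function of \<open>v\<close>, and the
  intermediate value theorem provides a \<open>v\<close> that meets the cache constraint.
\<close>

section \<open>Positivity of the success probability\<close>

text \<open>All terms are nonnegative; the summability that \<open>suminf_nonneg\<close> requires
  follows by comparison with the exponential series at \<open>(x / 2)\<^sup>2\<close>.\<close>

lemma bessel_I0_nonneg: "0 \<le> bessel_I0 x"
proof -
  have "summable (\<lambda>k. (x / 2) ^ (2 * k) / (fact k)\<^sup>2)"
  proof (rule summable_comparison_test')
    show "summable (\<lambda>k. inverse (fact k) * ((x / 2)\<^sup>2) ^ k)"
      by (rule summable_exp)
    fix k :: nat
    have "(1::real) \<le> fact k"
      by simp
    then have "(fact k :: real) \<le> (fact k)\<^sup>2"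
      by (simp add: power2_eq_square)
    then have "(x / 2) ^ (2 * k) / (fact k)\<^sup>2 \<le> (x / 2) ^ (2 * k) / fact k"
      by (intro divide_left_mono) auto
    moreover have "norm ((x / 2) ^ (2 * k) / (fact k)\<^sup>2) = (x / 2) ^ (2 * k) / (fact k)\<^sup>2"
      unfolding real_norm_def by (rule abs_of_nonneg) simp
    moreover have "(x / 2) ^ (2 * k) / fact k = inverse (fact k) * ((x / 2)\<^sup>2) ^ k"
      unfolding power_mult by (rule divide_inverse_commute)
    ultimately show "norm ((x / 2) ^ (2 * k) / (fact k)\<^sup>2) \<le> inverse (fact k) * ((x / 2)\<^sup>2) ^ k"
      by (simp only:)
  qed
  then show ?thesis
    unfolding bessel_I0_def by (rule suminf_nonneg) auto
qed

lemma bessel_I0_measurable [measurable]: "bessel_I0 \<in> borel_measurable borel"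
  unfolding bessel_I0_def[abs_def] by measurable

text \<open>Covers non-integrable \<open>f\<close> too, whose integral is 0 by convention; the
  bounds on both factors thus need no convergence argument.\<close>

lemma set_integral_Ioi_nonneg:
  fixes f :: "real \<Rightarrow> real"
  assumes "\<And>x. 0 < x \<Longrightarrow> 0 \<le> f x"
  shows "0 \<le> (LBINT x:{0<..}. f x)"
  unfolding set_lebesgue_integral_def
  by (rule integral_nonneg_AE) (use assms in \<open>auto simp: indicator_def\<close>)

lemma inter_cluster_factor_le_1:
  assumes "lam \<ge> 0" "n \<ge> 0" "p \<ge> 0" "t \<ge> 0"
  shows "inter_cluster_factor lam \<sigma> \<alpha> n p t \<le> 1"
proof -
  have "0 \<le> (LBINT u:{0<..}. t / (t + u powr \<alpha>) * rice_density \<sigma> v u)" for v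
    unfolding rice_density_def
    by (rule set_integral_Ioi_nonneg) (use assms in \<open>auto simp: bessel_I0_nonneg\<close>)
  then have "0 \<le> (LBINT v:{0<..}. (1 - exp (- p * n *
                 (LBINT u:{0<..}. t / (t + u powr \<alpha>) * rice_density \<sigma> v u))) * v)"
    by (intro set_integral_Ioi_nonneg) (use assms in auto)
  then show ?thesis
    unfolding inter_cluster_factor_def using assms by auto
qed

lemma intra_cluster_factor_le_1:
  assumes "n \<ge> 0" "p \<ge> 0" "t \<ge> 0"
  shows "intra_cluster_factor \<sigma> \<alpha> n p t \<le> 1"
proof -
  have "0 \<le> (LBINT h:{0<..}. t / (t + h powr \<alpha>) * (h / (2 * \<sigma>\<^sup>2)) * exp (- h\<^sup>2 / (4 * \<sigma>\<^sup>2)))"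
    by (rule set_integral_Ioi_nonneg) (use assms in auto)
  then show ?thesis
    unfolding intra_cluster_factor_def using assms by auto
qed

lemma inter_cluster_factor_measurable [measurable]:
  "inter_cluster_factor lam \<sigma> \<alpha> n p \<in> borel_measurable borel"
  unfolding inter_cluster_factor_def[abs_def] rice_density_def set_lebesgue_integral_def
  by measurable

lemma intra_cluster_factor_measurable [measurable]:
  "intra_cluster_factor \<sigma> \<alpha> n p \<in> borel_measurable borel"
  unfolding intra_cluster_factor_def[abs_def] set_lebesgue_integral_def
  by measurable

text \<open>A nonnegative function whose antiderivative has finite limits at 0 and at infinity is
  integrable. It will dominate the integrand of the success probability.\<close>

lemma rayleigh_density_integrable:
  fixes \<sigma> :: real
  assumes "\<sigma> > 0"
  shows "set_integrable lborel {0<..} (\<lambda>r. r / (2 * \<sigma>\<^sup>2) * exp (- r\<^sup>2 / (4 * \<sigma>\<^sup>2)))"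
proof -
  have "set_integrable lborel (einterval 0 \<infinity>) (\<lambda>r. r / (2 * \<sigma>\<^sup>2) * exp (- r\<^sup>2 / (4 * \<sigma>\<^sup>2)))"
  proof (rule interval_integral_FTC_nonneg(1))
    let ?F = "\<lambda>r. - exp (- r\<^sup>2 / (4 * \<sigma>\<^sup>2)) :: real"
    show "DERIV ?F x :> x / (2 * \<sigma>\<^sup>2) * exp (- x\<^sup>2 / (4 * \<sigma>\<^sup>2))" for x
      using assms by (auto intro!: derivative_eq_intros simp: field_simps)
    show "((?F \<circ> real_of_ereal) \<longlongrightarrow> -1) (at_right 0)"
      unfolding zero_ereal_def
    proof (subst ereal_tendsto_simps)
      have "(?F \<longlongrightarrow> ?F 0) (at_right 0)"
        using assms by (intro tendsto_intros) auto
      then show "(?F \<longlongrightarrow> -1) (at_right 0)" by simp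
    qed
    show "((?F \<circ> real_of_ereal) \<longlongrightarrow> 0) (at_left \<infinity>)"
    proof (subst ereal_tendsto_simps)
      have "filterlim (\<lambda>r. r\<^sup>2 * (1 / (4 * \<sigma>\<^sup>2))) at_top at_top"
        by (rule filterlim_at_top_mult_tendsto_pos[OF tendsto_const])
           (use assms in \<open>auto intro!: filterlim_pow_at_top filterlim_ident\<close>)
      then have "filterlim (\<lambda>r. - (r\<^sup>2 * (1 / (4 * \<sigma>\<^sup>2)))) at_bot at_top"
        by (simp add: filterlim_uminus_at_bot)
      then have "((\<lambda>r. - exp (- (r\<^sup>2 * (1 / (4 * \<sigma>\<^sup>2))))) \<longlongrightarrow> - 0) at_top"
        by (intro tendsto_minus filterlim_compose[OF exp_at_bot])
      then show "(?F \<longlongrightarrow> 0) at_top"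
        by simp
    qed
  qed (use assms in \<open>auto intro!: continuous_intros AE_I2\<close>)
  then show ?thesis
    by (simp add: einterval_def zero_ereal_def greaterThan_def)
qed

text \<open>The integrand is positive on the half-line and dominated by the Rayleigh density, so it
  is integrable and the default value 0 cannot arise. Strict concavity of the gain rests on this
  positivity.\<close>

lemma d2d_success_prob_pos:
  assumes "lam \<ge> 0" "\<sigma> > 0" "\<theta> \<ge> 0" "n \<ge> 0" "p \<ge> 0"
  shows "d2d_success_prob lam \<sigma> \<theta> \<alpha> n p > 0"
proof -
  define R where "R = (\<lambda>r::real. r / (2 * \<sigma>\<^sup>2) * exp (- r\<^sup>2 / (4 * \<sigma>\<^sup>2)))"
  define A where "A = (\<lambda>r. inter_cluster_factor lam \<sigma> \<alpha> n p (\<theta> * r powr \<alpha>))"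
  define B where "B = (\<lambda>r. intra_cluster_factor \<sigma> \<alpha> n p (\<theta> * r powr \<alpha>))"
  define f where "f = (\<lambda>r. indicator {0<..} r *\<^sub>R (R r * A r * B r))"
  have A: "0 < A r" "A r \<le> 1" and B: "0 < B r" "B r \<le> 1" for r
    using assms unfolding A_def B_def
    by (auto intro!: inter_cluster_factor_le_1 intra_cluster_factor_le_1)
       (simp_all add: inter_cluster_factor_def intra_cluster_factor_def)
  have R: "0 < R r" if "0 < r" for r
    using that assms by (simp add: R_def)
  have f_pos: "0 < f r" if "0 < r" for r
    using A B R that by (simp add: f_def)
  have f_nonneg: "0 \<le> f r" for r
    using f_pos[of r] by (cases "0 < r") (auto simp: f_def)
  have int: "integrable lborel f"
  proof (rule Bochner_Integration.integrable_bound)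
    show "integrable lborel (\<lambda>r. indicator {0<..} r *\<^sub>R R r)"
      using rayleigh_density_integrable[OF \<open>\<sigma> > 0\<close>] by (simp add: set_integrable_def R_def)
    show "f \<in> borel_measurable lborel"
      unfolding f_def R_def A_def B_def by measurable
    have "\<bar>R r * A r * B r\<bar> \<le> \<bar>R r\<bar>" if "0 < r" for r
    proof -
      have "R r * (A r * B r) \<le> R r"
        using A B R[OF that] by (intro mult_left_le mult_le_one) (auto simp: less_imp_le)
      moreover have "0 < R r * A r * B r"
        using A B R[OF that] by simp
      ultimately show ?thesis
        using R[OF that] by (simp only: abs_of_pos mult.assoc)
    qed
    then show "AE r in lborel. norm (f r) \<le> norm (indicator {0<..} r *\<^sub>R R r)"
      by (intro AE_I2) (simp add: f_def indicator_def)
  qed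
  have "integral\<^sup>L lborel f \<noteq> 0"
  proof
    assume "integral\<^sup>L lborel f = 0"
    then have "AE r in lborel. f r = 0"
      using integral_nonneg_eq_0_iff_AE[OF int] f_nonneg by simp
    \<comment> \<open>Any measurable subset of the half-line with positive measure gives the
      contradiction.\<close>
    then have "AE r in lborel. r \<notin> {0<..<1::real}"
      by eventually_elim (use f_pos in force)
    then have "{0<..<1::real} \<in> null_sets lborel"
      by (subst AE_iff_null_sets) auto
    then have "emeasure lborel {0<..<1::real} = 0"
      by (rule null_setsD1)
    then show False
      by (subst (asm) emeasure_lborel_Ioo) auto
  qed
  moreover have "integral\<^sup>L lborel f \<ge> 0"
    using f_nonneg by simp
  moreover have "d2d_success_prob lam \<sigma> \<theta> \<alpha> n p = integral\<^sup>L lborel f"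
    by (simp add: d2d_success_prob_def set_lebesgue_integral_def f_def R_def A_def B_def)
  ultimately show ?thesis by simp
qed

section \<open>The gain of a single file\<close>

definition file_gain :: "real \<Rightarrow> real \<Rightarrow> real \<Rightarrow> real \<Rightarrow> real" where
  "file_gain n P q x = q * x + q * (1 - x) * (1 - exp (- x * n)) * P"

definition marginal_gain :: "real \<Rightarrow> real \<Rightarrow> real \<Rightarrow> real \<Rightarrow> real" where
  "marginal_gain n P q x = q + q * (n * (1 - x) * exp (- n * x) - (1 - exp (- n * x))) * P"

lemma offloading_gain_eq:
  "offloading_gain lam \<sigma> \<theta> \<alpha> n q p b =
     (\<Sum>i\<in>UNIV. file_gain n (d2d_success_prob lam \<sigma> \<theta> \<alpha> n p) (q i) (b $ i))"
  by (simp add: offloading_gain_def file_gain_def)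

lemma psi_eq_iff_marginal_gain: "psi_eq n P q v x \<longleftrightarrow> v = marginal_gain n P q x"
  by (simp add: psi_eq_def marginal_gain_def)

text \<open>The endpoint values of the marginal gain are the two thresholds with which
  \<open>opt_caching\<close> compares \<open>v\<close>.\<close>

lemma marginal_gain_0: "marginal_gain n P q 0 = q + n * q * P"
  by (simp add: marginal_gain_def)

lemma marginal_gain_1: "marginal_gain n P q 1 = q - q * (1 - exp (- n)) * P"
  by (simp add: marginal_gain_def algebra_simps)

lemma continuous_on_marginal_gain: "continuous_on S (marginal_gain n P q)"
  unfolding marginal_gain_def[abs_def] by (intro continuous_intros)

lemma file_gain_has_derivative:
  "(file_gain n P q has_real_derivative marginal_gain n P q x) (at x)"
  unfolding file_gain_def[abs_def] marginal_gain_def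
  by (auto intro!: derivative_eq_intros simp: algebra_simps)

context
  fixes n P q :: real
  assumes pos: "n > 0" "P > 0" "q > 0"
begin

text \<open>A uniform slope bound, rather than mere monotonicity, later gives Lipschitz dependence
  on \<open>v\<close>. The difference splits into the decrease of the exponential, with nonnegative
  weight \<open>n * (1 - x) + 1\<close>, and a linear part, where \<open>exp (- n * y)\<close> is at
  least \<open>exp (- n)\<close>.\<close>

lemma marginal_gain_decrease:
  assumes "0 \<le> x" "x \<le> y" "y \<le> 1"
  shows "q * P * n * exp (- n) * (y - x) \<le> marginal_gain n P q x - marginal_gain n P q y"
proof -
  have "exp (- n) \<le> exp (- n * y)"
    using assms pos by simp
  then have 1: "exp (- n) * (n * (y - x)) \<le> exp (- n * y) * (n * (y - x))"
    using assms pos by (intro mult_right_mono) auto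
  have "exp (- n * y) \<le> exp (- n * x)"
    using assms pos by simp
  then have 2: "0 \<le> (exp (- n * x) - exp (- n * y)) * (n * (1 - x) + 1)"
    using assms pos by (intro mult_nonneg_nonneg) auto
  have "(q * P) * (exp (- n) * (n * (y - x))) \<le>
        (q * P) * ((exp (- n * x) - exp (- n * y)) * (n * (1 - x) + 1) + exp (- n * y) * (n * (y - x)))"
    using add_mono[OF 2 1] pos by (intro mult_left_mono) auto
  also have "\<dots> = marginal_gain n P q x - marginal_gain n P q y"
    by (simp add: marginal_gain_def algebra_simps)
  finally show ?thesis
    by (simp add: mult_ac)
qed

lemma marginal_gain_strict_decreasing:
  assumes "0 \<le> x" "x < y" "y \<le> 1"
  shows "marginal_gain n P q y < marginal_gain n P q x"
proof -
  have "0 < q * P * n * exp (- n) * (y - x)"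
    using assms pos by simp
  then show ?thesis
    using marginal_gain_decrease[of x y] assms by simp
qed

text \<open>The mean value theorem turns the strict decrease of the derivative into a strict tangent
  bound on either side of \<open>x\<close>. Strictness is what makes the maximiser unique.\<close>

lemma file_gain_tangent:
  assumes "x \<in> {0..1}" "y \<in> {0..1}" "x \<noteq> y"
  shows "file_gain n P q y < file_gain n P q x + marginal_gain n P q x * (y - x)"
proof (cases "x < y")
  case True
  then obtain z where z: "x < z" "z < y"
    "file_gain n P q y - file_gain n P q x = (y - x) * marginal_gain n P q z"
    using MVT2[of x y "file_gain n P q" "marginal_gain n P q"] file_gain_has_derivative by blast
  then have "(y - x) * marginal_gain n P q z < (y - x) * marginal_gain n P q x"
    using assms True by (intro mult_strict_left_mono marginal_gain_strict_decreasing) auto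
  then show ?thesis
    unfolding z(3)[symmetric] by (simp only: mult.commute[of _ "y - x"] less_diff_eq diff_less_eq add.commute)
next
  case False
  with assms have "y < x" by simp
  then obtain z where z: "y < z" "z < x"
    "file_gain n P q x - file_gain n P q y = (x - y) * marginal_gain n P q z"
    using MVT2[of y x "file_gain n P q" "marginal_gain n P q"] file_gain_has_derivative by blast
  then have "(x - y) * marginal_gain n P q x < (x - y) * marginal_gain n P q z"
    using assms \<open>y < x\<close> by (intro mult_strict_left_mono marginal_gain_strict_decreasing) auto
  with z show ?thesis by (simp add: algebra_simps)
qed

text \<open>Weighting the tangent bounds at the convex combination \<open>z\<close> by
  \<open>u\<close> and \<open>w\<close> cancels the slope terms.\<close>

lemma file_gain_concave:
  assumes "x \<in> {0..1}" "y \<in> {0..1}" "0 \<le> u" "0 \<le> w" "u + w = 1"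
  shows "u * file_gain n P q x + w * file_gain n P q y \<le> file_gain n P q (u * x + w * y)"
proof -
  define z where "z = u * x + w * y"
  have z: "z \<in> {0..1}"
    using convexD[OF convex_real_interval(5) assms(1-5)] by (simp add: z_def)
  have tan: "file_gain n P q t \<le> file_gain n P q z + marginal_gain n P q z * (t - z)"
    if "t \<in> {0..1}" for t
    using file_gain_tangent[OF z that] by (cases "z = t") auto
  have "u * file_gain n P q x + w * file_gain n P q y \<le>
      u * (file_gain n P q z + marginal_gain n P q z * (x - z)) +
      w * (file_gain n P q z + marginal_gain n P q z * (y - z))"
    using assms tan by (intro add_mono mult_left_mono) auto
  also have "\<dots> = (u + w) * file_gain n P q z + marginal_gain n P q z * (z - (u + w) * z)"
    by (simp add: z_def algebra_simps)
  also have "\<dots> = file_gain n P q z"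
    using assms by simp
  finally show ?thesis by (simp add: z_def)
qed

text \<open>Existence comes from the intermediate value theorem, uniqueness from strict decrease;
  hence the \<open>THE\<close> in \<open>psi\<close> denotes for every \<open>v\<close> between the
  thresholds.\<close>

lemma psi_eq_ex1:
  assumes "q - q * (1 - exp (- n)) * P \<le> v" "v \<le> q + n * q * P"
  shows "\<exists>!x. x \<in> {0..1} \<and> psi_eq n P q v x"
proof (rule ex_ex1I)
  show "\<exists>x. x \<in> {0..1} \<and> psi_eq n P q v x"
    using IVT2'[of "marginal_gain n P q" 1 v 0] assms continuous_on_marginal_gain
    by (auto simp: marginal_gain_0 marginal_gain_1 psi_eq_iff_marginal_gain)
  show "x = y" if "x \<in> {0..1} \<and> psi_eq n P q v x" "y \<in> {0..1} \<and> psi_eq n P q v y" for x y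
    using that marginal_gain_strict_decreasing[of x y] marginal_gain_strict_decreasing[of y x]
    by (cases x y rule: linorder_cases) (auto simp: psi_eq_iff_marginal_gain)
qed

end

section \<open>Optimality conditions and the choice of the multiplier\<close>

context
  fixes n P :: real and q :: "'f::finite \<Rightarrow> real"
  assumes pos: "n > 0" "P > 0" "\<And>i. q i > 0"
begin

text \<open>Complementary slackness at multiplier \<open>v\<close>: an active bound leaves a
  one-sided inequality, while an interior point satisfies both and so has marginal gain exactly
  \<open>v\<close>.\<close>

lemma opt_caching_KKT:
  fixes v :: real and i :: 'f
  defines "x \<equiv> opt_caching n P q v $ i"
  shows "x \<in> {0..1}"
    and "0 < x \<Longrightarrow> v \<le> marginal_gain n P (q i) x"
    and "x < 1 \<Longrightarrow> marginal_gain n P (q i) x \<le> v"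
proof -
  consider (full) "x = 1" "v < marginal_gain n P (q i) 1"
    | (none) "x = 0" "marginal_gain n P (q i) 0 < v"
    | (partial) "x = psi n P (q i) v" "q i - q i * (1 - exp (- n)) * P \<le> v" "v \<le> q i + n * q i * P"
    unfolding x_def opt_caching_def marginal_gain_0 marginal_gain_1
    by (simp split: if_splits) argo
  then have "x \<in> {0..1} \<and> (0 < x \<longrightarrow> v \<le> marginal_gain n P (q i) x)
      \<and> (x < 1 \<longrightarrow> marginal_gain n P (q i) x \<le> v)"
  proof cases
    case partial
    have "x \<in> {0..1} \<and> psi_eq n P (q i) v x"
      unfolding partial(1) psi_def using psi_eq_ex1[OF pos partial(2,3)] by (rule theI')
    then show ?thesis by (simp add: psi_eq_iff_marginal_gain)
  qed auto
  then show "x \<in> {0..1}" "0 < x \<Longrightarrow> v \<le> marginal_gain n P (q i) x"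
    "x < 1 \<Longrightarrow> marginal_gain n P (q i) x \<le> v" by auto
qed

text \<open>Where the component at \<open>v\<close> exceeds that at \<open>w\<close>, the former is
  positive and the latter below 1, so the KKT inequalities bound the difference of marginal gains by
  \<open>w - v\<close>; dividing by the slope bound gives the estimate.\<close>

lemma opt_caching_diff_le:
  assumes "v \<le> w"
  shows "\<bar>opt_caching n P q v $ i - opt_caching n P q w $ i\<bar> \<le> (w - v) / (q i * P * n * exp (- n))"
proof -
  define m where "m = q i * P * n * exp (- n)"
  have m: "m > 0" using pos by (simp add: m_def)
  \<comment> \<open>Stated for an arbitrary pair, so that both orders together bound the absolute
    value.\<close>
  have *: "\<bar>w - v\<bar> \<ge> m * (opt_caching n P q v $ i - opt_caching n P q w $ i)" for v w
  proof (cases "opt_caching n P q w $ i < opt_caching n P q v $ i")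
    case True
    then have "m * (opt_caching n P q v $ i - opt_caching n P q w $ i) \<le>
      marginal_gain n P (q i) (opt_caching n P q w $ i) - marginal_gain n P (q i) (opt_caching n P q v $ i)"
      unfolding m_def using pos opt_caching_KKT(1)[of v i] opt_caching_KKT(1)[of w i]
      by (intro marginal_gain_decrease) auto
    also have "\<dots> \<le> w - v"
      using True opt_caching_KKT[of v i] opt_caching_KKT[of w i] by auto
    finally show ?thesis by linarith
  next
    case False
    then have "m * (opt_caching n P q v $ i - opt_caching n P q w $ i) \<le> 0"
      using m by (intro mult_nonneg_nonpos) auto
    then show ?thesis by linarith
  qed
  have "\<bar>m * (opt_caching n P q v $ i - opt_caching n P q w $ i)\<bar> \<le> w - v"
    using *[of v w] *[of w v] assms by (intro abs_leI) (simp_all add: algebra_simps)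
  then have "m * \<bar>opt_caching n P q v $ i - opt_caching n P q w $ i\<bar> \<le> w - v"
    using m by (simp add: abs_mult)
  then show ?thesis
    using m unfolding m_def[symmetric] by (simp add: field_simps)
qed

lemma continuous_on_opt_caching: "continuous_on S (\<lambda>v. opt_caching n P q v $ i)"
proof -
  define L where "L = 1 / (q i * P * n * exp (- n))"
  have "L-lipschitz_on S (\<lambda>v. opt_caching n P q v $ i)"
  proof (rule lipschitz_onI)
    fix v w :: real
    show "dist (opt_caching n P q v $ i) (opt_caching n P q w $ i) \<le> L * dist v w"
      using opt_caching_diff_le[of v w i] opt_caching_diff_le[of w v i]
      by (cases "v \<le> w") (auto simp: L_def dist_real_def abs_minus_commute)
  next
    show "0 \<le> L" using pos by (simp add: L_def less_imp_le)
  qed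
  then show ?thesis by (rule lipschitz_on_continuous_on)
qed

text \<open>Intermediate value theorem in \<open>v\<close>, between a level at which every file is
  cached with probability 1 and one at which every file has probability 0.\<close>

lemma opt_caching_sum_attained:
  assumes "0 \<le> s" "s \<le> real CARD('f)"
  shows "\<exists>v. (\<Sum>i\<in>UNIV. opt_caching n P q v $ i) = s"
proof -
  \<comment> \<open>Summing absolute values bounds all thresholds at once; the offset 1 makes the
    comparisons strict.\<close>
  define lo where "lo = - (\<Sum>i\<in>UNIV. \<bar>marginal_gain n P (q i) 1\<bar>) - 1"
  define hi where "hi = (\<Sum>i\<in>UNIV. \<bar>marginal_gain n P (q i) 0\<bar>) + 1"
  have lo: "lo < marginal_gain n P (q i) 1" for i
    using member_le_sum[of i UNIV "\<lambda>i. \<bar>marginal_gain n P (q i) 1\<bar>"] by (simp add: lo_def)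
  have hi: "marginal_gain n P (q i) 0 < hi" for i
    using member_le_sum[of i UNIV "\<lambda>i. \<bar>marginal_gain n P (q i) 0\<bar>"] by (simp add: hi_def)
  \<comment> \<open>\<open>opt_caching\<close> tests the lower threshold first, so \<open>hi\<close>
    must be seen to exceed that one as well.\<close>
  have gap: "marginal_gain n P (q i) 1 < marginal_gain n P (q i) 0" for i
    using pos by (intro marginal_gain_strict_decreasing) auto
  have "lo < hi"
    using lo[of undefined] gap[of undefined] hi[of undefined] by linarith
  have lo': "opt_caching n P q lo $ i = 1" for i
    using lo[of i] by (simp add: opt_caching_def marginal_gain_1)
  have hi': "opt_caching n P q hi $ i = 0" for i
    using hi[of i] gap[of i]
    by (simp add: opt_caching_def marginal_gain_1 marginal_gain_0)
  have "\<exists>v. lo \<le> v \<and> v \<le> hi \<and> (\<Sum>i\<in>UNIV. opt_caching n P q v $ i) = s"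
    using \<open>lo < hi\<close> assms
    by (intro IVT2' continuous_on_sum continuous_on_opt_caching) (auto simp: lo' hi')
  then show ?thesis by blast
qed

text \<open>Lagrangian argument: replacing the slopes in the tangent bounds by the common multiplier
  \<open>v\<close> and summing leaves a linear term, which vanishes because both vectors have the
  same sum.\<close>

lemma opt_caching_unique_max:
  assumes "feasible M (opt_caching n P q v)" "feasible M b" "b \<noteq> opt_caching n P q v"
  shows "(\<Sum>i\<in>UNIV. file_gain n P (q i) (b $ i)) <
    (\<Sum>i\<in>UNIV. file_gain n P (q i) (opt_caching n P q v $ i))"
proof -
  define c where "c = opt_caching n P q v"
  have b: "b $ i \<in> {0..1}" for i
    using assms by (simp add: feasible_def)
  \<comment> \<open>If \<open>c $ i = 1\<close>, then \<open>c $ i \<le> b $ i\<close> forces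
    equality; otherwise the sign of \<open>b $ i - c $ i\<close> selects the applicable KKT
    inequality.\<close>
  have kkt: "marginal_gain n P (q i) (c $ i) * (b $ i - c $ i) \<le> v * (b $ i - c $ i)" for i
  proof (cases "c $ i \<le> b $ i")
    case True
    show ?thesis
    proof (cases "c $ i < 1")
      case True
      with \<open>c $ i \<le> b $ i\<close> show ?thesis
        using opt_caching_KKT(3)[of v i] by (intro mult_right_mono) (auto simp: c_def)
    next
      case False
      with \<open>c $ i \<le> b $ i\<close> b[of i] have "b $ i = c $ i" by auto
      then show ?thesis by simp
    qed
  next
    case False
    then have "v \<le> marginal_gain n P (q i) (c $ i)"
      using opt_caching_KKT(2)[of v i] b[of i] by (auto simp: c_def)
    then show ?thesis
      using False by (intro mult_right_mono_neg) auto
  qed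
  have strict: "file_gain n P (q i) (b $ i) < file_gain n P (q i) (c $ i) + v * (b $ i - c $ i)"
    if "b $ i \<noteq> c $ i" for i
    using file_gain_tangent[OF pos, of "c $ i" "b $ i" i] that b[of i] opt_caching_KKT(1)[of v i] kkt[of i]
    by (auto simp: c_def)
  then have weak: "file_gain n P (q i) (b $ i) \<le> file_gain n P (q i) (c $ i) + v * (b $ i - c $ i)" for i
    by (cases "b $ i = c $ i") (auto simp: less_imp_le)
  obtain j where "b $ j \<noteq> c $ j"
    using assms(3) by (auto simp: vec_eq_iff c_def)
  then have "(\<Sum>i\<in>UNIV. file_gain n P (q i) (b $ i)) <
      (\<Sum>i\<in>UNIV. file_gain n P (q i) (c $ i) + v * (b $ i - c $ i))"
    using strict weak by (intro sum_strict_mono_ex1) auto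
  also have "\<dots> = (\<Sum>i\<in>UNIV. file_gain n P (q i) (c $ i)) + v * ((\<Sum>i\<in>UNIV. b $ i) - (\<Sum>i\<in>UNIV. c $ i))"
    by (simp add: sum.distrib sum_subtractf sum_distrib_left[symmetric])
  also have "\<dots> = (\<Sum>i\<in>UNIV. file_gain n P (q i) (c $ i))"
    using assms by (simp add: feasible_def c_def)
  finally show ?thesis by (simp add: c_def)
qed

end

section \<open>Zipf popularities and the full problem\<close>

lemma zipf_pos:
  assumes "i \<in> {1..N}"
  shows "zipf N \<beta> i > 0"
proof -
  have "0 < (\<Sum>k = 1..N. real k powr (- \<beta>))"
    using assms by (intro sum_pos) auto
  then show ?thesis using assms by (simp add: zipf_def)
qed

text \<open>The gain is separable, so concavity for each file adds up; the domain is the unit cube,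
  a \<open>cbox\<close>.\<close>

lemma concave_on_offloading_gain:
  assumes "n > 0" "d2d_success_prob lam \<sigma> \<theta> \<alpha> n p > 0" "\<And>i. q i > 0"
  shows "concave_on {b :: real ^ 'f::finite. \<forall>i. b $ i \<in> {0..1}} (offloading_gain lam \<sigma> \<theta> \<alpha> n q p)"
  unfolding concave_on_iff
proof (intro conjI ballI allI impI)
  have "{b :: real ^ 'f. \<forall>i. b $ i \<in> {0..1}} = cbox 0 1"
    by (auto simp: mem_box_cart)
  then show "convex {b :: real ^ 'f. \<forall>i. b $ i \<in> {0..1}}"
    by simp
next
  fix x y :: "real ^ 'f" and u w :: real
  assume "x \<in> {b. \<forall>i. b $ i \<in> {0..1}}" "y \<in> {b. \<forall>i. b $ i \<in> {0..1}}" "u \<ge> 0" "w \<ge> 0" "u + w = 1"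
  then show "u * offloading_gain lam \<sigma> \<theta> \<alpha> n q p x + w * offloading_gain lam \<sigma> \<theta> \<alpha> n q p y
      \<le> offloading_gain lam \<sigma> \<theta> \<alpha> n q p (u *\<^sub>R x + w *\<^sub>R y)"
    unfolding offloading_gain_eq sum_distrib_left sum.distrib[symmetric]
    using file_gain_concave[OF assms] by (intro sum_mono) simp
qed

text \<open>Vectors are indexed by a finite type, so \<open>idx\<close> supplies the file ranks. The
  second conjunct makes \<open>psi\<close> well defined, the third keeps the last from being
  vacuous, and the equivalence there includes uniqueness of the maximiser.\<close>

theorem lemma3:
  fixes M N_f :: nat
    and lam \<sigma> \<theta> \<alpha> \<beta> n p P :: real
    and idx :: "'f::finite \<Rightarrow> nat"
    and q :: "'f \<Rightarrow> real"
  assumes "1 \<le> M" and "M < N_f"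
    and idx: "bij_betw idx UNIV {1..N_f}"
    and "n > 0" and "lam > 0" and "\<sigma> > 0" and "\<theta> > 0" and "\<alpha> > 2" and "\<beta> \<ge> 0"
    and q: "\<And>i. q i = zipf N_f \<beta> (idx i)"
    and "0 < p" and "p \<le> 1"
    and P: "P = d2d_success_prob lam \<sigma> \<theta> \<alpha> n p"
  shows "concave_on {b :: real ^ 'f. \<forall>i. b $ i \<in> {0..1}} (offloading_gain lam \<sigma> \<theta> \<alpha> n q p)
    \<and> (\<forall>i v. q i - q i * (1 - exp (- n)) * P \<le> v \<and> v \<le> q i + n * q i * P
          \<longrightarrow> (\<exists>!x. x \<in> {0..1} \<and> psi_eq n P (q i) v x))
    \<and> (\<exists>v. (\<Sum>i\<in>UNIV. opt_caching n P q v $ i) = real M)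
    \<and> (\<forall>v. (\<Sum>i\<in>UNIV. opt_caching n P q v $ i) = real M
          \<longrightarrow> (\<forall>b. is_arg_max (offloading_gain lam \<sigma> \<theta> \<alpha> n q p) (feasible M) b
                 \<longleftrightarrow> b = opt_caching n P q v))"
proof -
  have P_pos: "P > 0"
    unfolding P using assms by (intro d2d_success_prob_pos) auto
  have q_pos: "q i > 0" for i
    unfolding q using bij_betwE[OF idx] by (intro zipf_pos) auto
  note pos = \<open>n > 0\<close> P_pos q_pos
  \<comment> \<open>Turns \<open>M < N_f\<close> into the upper bound on the sum under which
    \<open>real M\<close> is attained.\<close>
  have card: "CARD('f) = N_f"
    using bij_betw_same_card[OF idx] by simp
  have optimal: "is_arg_max (offloading_gain lam \<sigma> \<theta> \<alpha> n q p) (feasible M) b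
      \<longleftrightarrow> b = opt_caching n P q v"
    if "(\<Sum>i\<in>UNIV. opt_caching n P q v $ i) = real M" for b v
  proof -
    have feas: "feasible M (opt_caching n P q v)"
      using that opt_caching_KKT(1)[where q = q, OF pos] by (simp add: feasible_def)
    \<comment> \<open>Every other feasible vector is strictly worse, which yields both directions of
      the equivalence.\<close>
    have "offloading_gain lam \<sigma> \<theta> \<alpha> n q p b < offloading_gain lam \<sigma> \<theta> \<alpha> n q p (opt_caching n P q v)"
      if "feasible M b" "b \<noteq> opt_caching n P q v" for b
      using opt_caching_unique_max[OF pos feas that] by (simp add: offloading_gain_eq P)
    with feas show ?thesis
      unfolding is_arg_max_def by (metis less_asym)
  qed
  have "concave_on {b :: real ^ 'f. \<forall>i. b $ i \<in> {0..1}} (offloading_gain lam \<sigma> \<theta> \<alpha> n q p)"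
    using pos by (intro concave_on_offloading_gain) (simp_all add: P)
  moreover have "\<exists>v. (\<Sum>i\<in>UNIV. opt_caching n P q v $ i) = real M"
    using \<open>M < N_f\<close> by (intro opt_caching_sum_attained[OF pos]) (auto simp: card)
  ultimately show ?thesis
    using optimal psi_eq_ex1[OF pos] by blast
qed

end
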